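(* Let $d=2$ and let $(p_n)_{n\ge 2}$ be a sequence in $[0,1]$ with $\sum_n p_n=\infty$ which is eventually periodic, that is, there exist $r\ge 1$ and $n_0\in\mathbb{N}$ such that $p_{n+r}=p_n$ for all $n\ge n_0$. Let $S$ be the conservative random walk on $\mathbb{Z}^2$ started at the origin corresponding to $(p_n)$. Then the walk is not strongly transient; in fact $\mathbb{P}(\lim_{n\to\infty}|S_n|=\infty)=0$.
   Context: Conservative random walk on $\mathbb{Z}^d$, $d\ge 2$, corresponding to a sequence $(p_n)_{n\ge 2}$ in $[0,1]$ (with the convention $p_1:=1$): let $e_1,\dots,e_d$ be the standard basis vectors of $\mathbb{R}^d$. Let $Y_1$ be uniform on the $2d$-element set $\{\pm e_1,\dots,\pm e_d\}$, and let $Y_1,Y_2,\dots$ be the (time-inhomogeneous) Markov chain on this set whose transition matrix between times $n$ and $n+1$ is $(1-p_n)I+\frac{p_n}{2d}A$, $n\ge 1$, where $I$ is the $2d\times 2d$ identity matrix and $A$ the $2d\times 2d$ matrix of ones; i.e. with probability $1-p_n$ the next step repeats the previous one, and with probability $p_n$ a fresh direction is chosen uniformly among all $2d$ directions. Set $S_0=\mathbf{0}$, $S_n=Y_1+\dots+Y_n$. $|\cdot|$ is the Euclidean norm. The walk is called strongly transient if $\mathbb{P}(\lim_{n\to\infty}|S_n|=\infty)=1$. *)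

theory Defs
  imports "HOL-Probability.Probability"
begin

definition directions :: "(real ^ 'd) set" where
  "directions = {axis i 1 | i. True} \<union> {- axis i 1 | i. True}"

(* Transition matrix between times n and n + 1.  Sequences p are indexed from 2: the values p 0 and
   p 1 are never used, and p_1 = 1 by convention. *)
definition transition :: "(nat \<Rightarrow> real) \<Rightarrow> nat \<Rightarrow> real ^ 'd \<Rightarrow> real ^ 'd \<Rightarrow> real" where
  "transition p n x y =
     (let q = (if n = 1 then 1 else p n)
      in (1 - q) * of_bool (x = y) + q / (2 * real CARD('d)))"

(* Y is the sequence of steps, indexed from 1; the value Y 0 is never used. *)
locale conservative_random_walk = prob_space M
  for M :: "'w measure" and p :: "nat \<Rightarrow> real" and Y :: "nat \<Rightarrow> 'w \<Rightarrow> real ^ 'd" +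
  assumes p_range: "\<And>n. n \<ge> 2 \<Longrightarrow> p n \<in> {0..1}"
    and Y_directions: "\<And>n. n \<ge> 1 \<Longrightarrow> Y n \<in> M \<rightarrow>\<^sub>M count_space directions"
    and Y_initial: "distr M (count_space directions) (Y 1) = uniform_count_measure directions"
    and Y_markov: "\<And>n y. n \<ge> 1 \<Longrightarrow> (\<And>i. y i \<in> directions) \<Longrightarrow>
          \<P>(\<omega> in M. \<forall>i\<in>{1..n}. Y i \<omega> = y i) > 0 \<Longrightarrow>
          \<P>(\<omega> in M. Y (Suc n) \<omega> = y (Suc n) \<bar> \<forall>i\<in>{1..n}. Y i \<omega> = y i)
            = transition p n (y n) (y (Suc n))"

definition walk :: "(nat \<Rightarrow> 'w \<Rightarrow> real ^ 'd) \<Rightarrow> nat \<Rightarrow> 'w \<Rightarrow> real ^ 'd" where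
  "walk Y n \<omega> = (\<Sum>i = 1..n. Y i \<omega>)"

definition escape_event :: "'w measure \<Rightarrow> (nat \<Rightarrow> 'w \<Rightarrow> real ^ 'd) \<Rightarrow> 'w set" where
  "escape_event M S = {\<omega> \<in> space M. filterlim (\<lambda>n. norm (S n \<omega>)) at_top sequentially}"

definition strongly_transient :: "'w measure \<Rightarrow> (nat \<Rightarrow> 'w \<Rightarrow> real ^ 'd) \<Rightarrow> bool" where
  "strongly_transient M S \<longleftrightarrow> measure M (escape_event M S) = 1"

lemma card_directions: "card (directions :: (real ^ 'd) set) = 2 * CARD('d)"
proof -
  let ?A = "range (\<lambda>i::'d. axis i (1::real))"
  let ?B = "range (\<lambda>i::'d. - axis i (1::real))"
  have "axis i (1::real) \<noteq> - axis j 1" for i j :: 'd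
  proof
    assume "axis i (1::real) = - axis j 1"
    then have "axis i (1::real) $ i = (- axis j 1) $ i" by simp
    then show False by (auto simp: axis_def split: if_splits)
  qed
  then have "?A \<inter> ?B = {}" by auto
  moreover have "card ?A = CARD('d)" "card ?B = CARD('d)"
    by (auto intro!: card_image injI simp: axis_eq_axis)
  moreover have "(directions :: (real ^ 'd) set) = ?A \<union> ?B"
    by (auto simp: directions_def)
  moreover have "finite ?A" "finite ?B" by simp_all
  ultimately show ?thesis using card_Un_disjoint[of ?A ?B] by presburger
qed

(* The measure of a non-measurable set is 0 by convention, so this matters for "probability 0". *)
lemma (in conservative_random_walk) escape_event_measurable:
  "escape_event M (walk Y) \<in> events"
proof -
  have Y: "Y i \<in> borel_measurable M" if "i \<ge> 1" for i
    using measurable_compose[OF Y_directions[OF that], of "\<lambda>x. x" borel] by simp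
  have [measurable]: "walk Y n \<in> borel_measurable M" for n
    unfolding walk_def by (rule borel_measurable_sum) (use Y in simp)
  have "filterlim f at_top sequentially \<longleftrightarrow>
      (\<forall>k::nat. \<exists>N. \<forall>n\<ge>N. real k \<le> f n)" for f :: "nat \<Rightarrow> real"
    unfolding filterlim_at_top eventually_sequentially
    by (meson order_trans real_arch_simple)
  then have "escape_event M (walk Y) =
      {\<omega> \<in> space M. \<forall>k::nat. \<exists>N. \<forall>n\<ge>N. real k \<le> norm (walk Y n \<omega>)}"
    unfolding escape_event_def by simp
  also have "\<dots> \<in> events" by measurable
  finally show ?thesis .
qed

end

theory Submission
  imports Defs "HOL-Real_Asymp.Real_Asymp"
begin

text \<open>
  The proof is a Foster--Lyapunov argument.  Identify \<open>\<real>\<^sup>2\<close> with \<open>\<complex>\<close>.  Adding to \<open>S\<^sub>n\<close> the expected sum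
  \<open>h\<^sub>n Y\<^sub>n\<close> of all future steps gives a martingale \<open>Z\<^sub>n\<close> with bounded increments
  \<open>(1 + h\<^sub>n\<^sub>+\<^sub>1) (Y\<^sub>n\<^sub>+\<^sub>1 - (1 - p\<^sub>n) Y\<^sub>n)\<close>, where \<open>h\<close> is bounded by periodicity.  Fresh steps satisfy
  \<open>E Y\<^sup>2 = 0\<close> as complex numbers, so for a suitable bounded sequence \<open>\<kappa>\<^sub>n\<close> the function
  \<open>L = Re (2 Ln Z\<^sub>n - \<kappa>\<^sub>n Y\<^sub>n\<^sup>2 / Z\<^sub>n\<^sup>2)\<close> has drift only \<open>O(|Z\<^sub>n|\<^sup>-\<^sup>3)\<close>.  Its conditional variance
  is of order \<open>|Z\<^sub>n|\<^sup>-\<^sup>2\<close> whenever \<open>p\<^sub>n > 0\<close>, and \<open>L\<close> does not change at all when \<open>p\<^sub>n = 0\<close>; hence \<open>ln L\<close>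
  is a supermartingale as long as \<open>Z\<^sub>n\<close> stays outside a large disc.  A nonnegative supermartingale
  cannot tend to infinity with positive probability, so neither can \<open>|Z\<^sub>n|\<close>.
\<close>

section \<open>Drift of the Lyapunov function\<close>

text \<open>Real part of the Taylor expansion of \<open>Ln (1 + w)\<close>. For
  \<open>cmod x \<le> 1/2\<close> the third derivative \<open>2 / (1 + x) ^ 3\<close> is at most 16
  in modulus, and the remainder bound divides by \<open>fact 2\<close>, giving 8.\<close>

lemma ln_norm_one_plus_approx:
  fixes w :: complex
  assumes "cmod w \<le> 1/2"
  shows "\<bar>ln (cmod (1 + w)) - (Re w - Re (w\<^sup>2) / 2)\<bar> \<le> 8 * cmod w ^ 3"
proof -
  define f :: "nat \<Rightarrow> complex \<Rightarrow> complex" where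
    "f = (\<lambda>i x. if i = 0 then Ln (1 + x) else if i = 1 then inverse (1 + x)
      else if i = 2 then - inverse ((1 + x)\<^sup>2) else 2 * inverse ((1 + x) ^ 3))"
  let ?S = "cball (0 :: complex) (1/2)"
  have pos: "Re (1 + x) \<ge> 1/2" if "x \<in> ?S" for x
    using abs_Re_le_cmod[of x] that by simp
  have nz: "1 + x \<noteq> 0" if "x \<in> ?S" for x
  proof
    assume "1 + x = 0"
    then have "Re (1 + x) = 0" by (simp only: zero_complex.sel)
    with pos[OF that] show False by linarith
  qed
  have half: "cmod (1 + x) \<ge> 1/2" if "x \<in> ?S" for x
    using pos[OF that] complex_Re_le_cmod[of "1 + x"] by linarith
  have "cmod (f 0 w - (\<Sum>i\<le>2. f i 0 * (w - 0) ^ i / fact i)) \<le> 16 * cmod (w - 0) ^ Suc 2 / fact 2"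
  proof (rule complex_Taylor[of ?S])
    fix i :: nat and x assume x: "x \<in> ?S" and "i \<le> 2"
    then have cut: "1 + x \<notin> \<real>\<^sub>\<le>\<^sub>0"
      using pos[OF x] by (auto simp: complex_nonpos_Reals_iff)
    consider "i = 0" | "i = 1" | "i = 2" using \<open>i \<le> 2\<close> by linarith
    then show "(f i has_field_derivative f (Suc i) x) (at x within ?S)"
    proof cases
      case 1 then show ?thesis using cut nz[OF x] unfolding f_def
        by (auto intro!: derivative_eq_intros simp: field_simps)
    next
      case 2 then show ?thesis using nz[OF x] unfolding f_def
        by (auto intro!: derivative_eq_intros simp: field_simps power2_eq_square)
    next
      case 3 then show ?thesis using nz[OF x] unfolding f_def
        by (auto intro!: derivative_eq_intros simp: divide_simps power2_eq_square eval_nat_numeral)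
    qed
  next
    fix x assume x: "x \<in> ?S"
    have "(1/2) ^ 3 \<le> cmod (1 + x) ^ 3"
      by (rule power_mono) (use half[OF x] in auto)
    then have "inverse (cmod (1 + x) ^ 3) \<le> inverse ((1/2) ^ 3)"
      by (rule le_imp_inverse_le) simp
    then show "cmod (f (Suc 2) x) \<le> 16"
      by (simp add: f_def norm_mult norm_inverse norm_power power_divide)
  qed (use assms in auto)
  then have "cmod (Ln (1 + w) - (w - w\<^sup>2 / 2)) \<le> 8 * cmod w ^ 3"
    by (simp add: f_def numeral_2_eq_2 eval_nat_numeral algebra_simps)
  then have "\<bar>Re (Ln (1 + w) - (w - w\<^sup>2 / 2))\<bar> \<le> 8 * cmod w ^ 3"
    using abs_Re_le_cmod order_trans by blast
  moreover have "1 + w \<noteq> 0" using nz[of w] assms by simp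
  ultimately show ?thesis by simp
qed

text \<open>The right side minus the left has derivative \<open>y * (1 - y) / (2 * (1 + y))\<close>,
  which has the sign of \<open>y\<close>, so its minimum is at 0. The quadratic gain later turns
  variance into negative drift of a logarithm.\<close>

lemma ln_one_plus_le_quadratic:
  fixes x :: real
  assumes "\<bar>x\<bar> \<le> 1/2"
  shows "ln (1 + x) \<le> x - x\<^sup>2 / 4"
proof -
  let ?f = "\<lambda>x::real. x - x\<^sup>2 / 4 - ln (1 + x)"
  have deriv: "(?f has_real_derivative y / (1 + y) * ((1 - y) / 2)) (at y)" if "\<bar>y\<bar> \<le> 1/2" for y
    using that by (auto intro!: derivative_eq_intros simp: field_simps power2_eq_square)
  show ?thesis
  proof (cases "x \<ge> 0")
    case True
    have "?f 0 \<le> ?f x"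
    proof (rule DERIV_nonneg_imp_nondecreasing[OF True])
      fix y assume "0 \<le> y" "y \<le> x"
      then show "\<exists>z. (?f has_real_derivative z) (at y) \<and> 0 \<le> z"
        using assms deriv[of y] by (intro exI[of _ "y / (1 + y) * ((1 - y) / 2)"]) auto
    qed
    then show ?thesis by simp
  next
    case False
    have "?f x \<ge> ?f 0"
    proof (rule DERIV_nonpos_imp_nonincreasing[of x 0 ?f])
      fix y assume "x \<le> y" "y \<le> 0"
      then show "\<exists>z. (?f has_real_derivative z) (at y) \<and> z \<le> 0"
        using assms deriv[of y]
        by (intro exI[of _ "y / (1 + y) * ((1 - y) / 2)"])
          (auto intro!: mult_nonpos_nonneg divide_nonpos_nonneg)
    qed (use False in simp)
    then show ?thesis by simp
  qed
qed

section \<open>One-step averages and the Lyapunov function\<close>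

definition units :: "complex set" where "units = {1, -1, \<i>, -\<i>}"

text \<open>Conditional expectation of \<open>f\<close> at the next step when the current one is
  \<open>y\<close> and a fresh draw has probability \<open>p\<close>.\<close>

definition redraw :: "real \<Rightarrow> complex \<Rightarrow> (complex \<Rightarrow> real) \<Rightarrow> real" where
  "redraw p y f = (1 - p) * f y + p * (f 1 + f (-1) + f \<i> + f (-\<i>)) / 4"

text \<open>The real part of \<open>2 Ln z - k y\<^sup>2 / z\<^sup>2\<close>.  The logarithm is harmonic, and the
  correction, with \<open>k\<close> as in \<open>redraw_taylor\<close>, absorbs the second-order term that arises because
  a step is not isotropic given its predecessor \<open>y\<close>.\<close>

definition lyap :: "real \<Rightarrow> complex \<Rightarrow> complex \<Rightarrow> real" where
  "lyap k y z = 2 * ln (cmod z) - k * Re (y\<^sup>2 / z\<^sup>2)"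

lemma norm_units: "y \<in> units \<Longrightarrow> cmod y = 1"
  by (auto simp: units_def)

lemma redraw_mono:
  assumes "0 \<le> p" "p \<le> 1" "y \<in> units" "\<And>e. e \<in> units \<Longrightarrow> f e \<le> g e"
  shows "redraw p y f \<le> redraw p y g"
proof -
  have "f 1 + f (-1) + f \<i> + f (-\<i>) \<le> g 1 + g (-1) + g \<i> + g (-\<i>)"
    by (intro add_mono assms(4)) (simp_all add: units_def)
  moreover have "f y \<le> g y" using assms by blast
  ultimately show ?thesis unfolding redraw_def
    by (intro add_mono divide_right_mono mult_left_mono) (use assms(1,2) in \<open>simp_all add: assms(4) units_def\<close>)
qed

lemma redraw_affine:
  "redraw p y (\<lambda>e. a * f e + b * g e + c) = a * redraw p y f + b * redraw p y g + c"
  by (simp add: redraw_def field_simps)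

text \<open>The integrand is the second-order expansion of the increment of \<open>lyap\<close>. Its
  linear part has mean 0 because \<open>(1 - p) * y\<close> is the mean of the next step. Fresh
  steps average \<open>e\<close> and \<open>e\<^sup>2\<close> to 0, so the centred square has mean
  \<open>p * (1 - p) * y\<^sup>2\<close>, which the relation between \<open>k\<close> and
  \<open>k'\<close> cancels.\<close>

lemma redraw_taylor:
  fixes z y :: complex and H p k' :: real
  assumes "k = (1 - p) * k' + H\<^sup>2 * p * (1 - p)" "z \<noteq> 0"
  shows "redraw p y (\<lambda>e. 2 * Re (H * (e - complex_of_real (1 - p) * y) / z) - Re ((H * (e - complex_of_real (1 - p) * y) / z)\<^sup>2)
     - k' * Re (e\<^sup>2 / z\<^sup>2) + k * Re (y\<^sup>2 / z\<^sup>2)) = 0" (is "redraw p y ?f = 0")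
proof -
  define F where "F = (\<lambda>e. 2 * (H * (e - complex_of_real (1 - p) * y) / z) - (H * (e - complex_of_real (1 - p) * y) / z)\<^sup>2
     - k' * (e\<^sup>2 / z\<^sup>2) + k * (y\<^sup>2 / z\<^sup>2))"
  have f: "?f e = Re (F e)" for e
    by (simp add: F_def flip: times_divide_eq_right)
  have "4 * ((1 - p) * F y) + p * (F 1 + F (-1) + F \<i> + F (-\<i>)) = 0"
    unfolding F_def assms(1) using assms(2)
    by (simp add: divide_simps) (simp add: algebra_simps power2_eq_square)
  then have "Re (4 * ((1 - p) * F y) + p * (F 1 + F (-1) + F \<i> + F (-\<i>))) = 0" by simp
  then show ?thesis unfolding redraw_def f by (simp add: field_simps)
qed

text \<open>By symmetry of the four directions the fresh draw contributes exactly the right-hand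
  side; centring at \<open>(1 - p) * y\<close> adds the nonnegative term
  \<open>p * (1 - p) * X\<^sup>2\<close>.\<close>

lemma redraw_variance:
  fixes y w :: complex
  assumes "0 \<le> p" "p \<le> 1" "y \<in> units"
  shows "redraw p y (\<lambda>e. (Re (w * (e - complex_of_real (1 - p) * y)))\<^sup>2) \<ge> p * (cmod w)\<^sup>2 / 2"
proof -
  define X where "X = Re (w * y)"
  have "redraw p y (\<lambda>e. (Re (w * (e - complex_of_real (1 - p) * y)))\<^sup>2)
      = p * (cmod w)\<^sup>2 / 2 + p * (1 - p) * X\<^sup>2"
    unfolding redraw_def X_def cmod_power2
    by (simp add: field_simps power2_eq_square)
  then show ?thesis using assms by simp
qed

lemma abs_correction_le:
  assumes "\<bar>k\<bar> \<le> B" "y \<in> units"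
  shows "\<bar>k * Re (y\<^sup>2 / z\<^sup>2)\<bar> \<le> B / (cmod z)\<^sup>2"
proof -
  have "\<bar>Re (y\<^sup>2 / z\<^sup>2)\<bar> \<le> 1 / (cmod z)\<^sup>2"
    using abs_Re_le_cmod[of "y\<^sup>2 / z\<^sup>2"] norm_units[OF assms(2)]
    by (simp add: norm_divide norm_power)
  then have "\<bar>k\<bar> * \<bar>Re (y\<^sup>2 / z\<^sup>2)\<bar> \<le> B * (1 / (cmod z)\<^sup>2)"
    using assms by (intro mult_mono) auto
  then show ?thesis by (simp add: abs_mult)
qed

text \<open>Factor a difference of squares; as \<open>cmod z'\<close> is at least half of
  \<open>cmod z\<close>, the numerator is at most \<open>3 * r * d\<close> and the denominator at
  least \<open>r ^ 4 / 4\<close>.\<close>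

lemma norm_inverse_square_diff:
  fixes z z' :: complex
  assumes "cmod (z' - z) \<le> d" "2 * d \<le> cmod z" "z \<noteq> 0"
  shows "cmod (1 / z'\<^sup>2 - 1 / z\<^sup>2) \<le> 12 * d / cmod z ^ 3"
proof -
  define r where "r = cmod z"
  have r: "0 < r" "2 * d \<le> r" using assms by (auto simp: r_def)
  have d: "0 \<le> d" using assms(1) norm_ge_zero order_trans by blast
  have lo: "r / 2 \<le> cmod z'" and hi: "cmod z' \<le> 3 * r / 2"
    using assms(1,2) norm_triangle_ineq3[of z' z] unfolding r_def by linarith+
  have "z' \<noteq> 0" using lo r by auto
  then have "1 / z'\<^sup>2 - 1 / z\<^sup>2 = (z - z') * (z + z') / (z\<^sup>2 * z'\<^sup>2)"
    using assms(3) by (simp add: divide_simps) (simp add: algebra_simps power2_eq_square)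
  also have "cmod \<dots> = cmod (z' - z) * cmod (z + z') / (r\<^sup>2 * (cmod z')\<^sup>2)"
    by (simp add: norm_mult norm_divide norm_power r_def norm_minus_commute)
  also have "\<dots> \<le> d * (3 * r) / (r\<^sup>2 * (r / 2)\<^sup>2)"
  proof (rule frac_le)
    have "cmod (z + z') \<le> 3 * r"
      using norm_triangle_ineq[of z z'] hi r unfolding r_def by linarith
    then show "cmod (z' - z) * cmod (z + z') \<le> d * (3 * r)"
      using assms(1) d by (intro mult_mono) auto
    show "r\<^sup>2 * (r / 2)\<^sup>2 \<le> r\<^sup>2 * (cmod z')\<^sup>2"
      using lo r by (intro mult_left_mono power_mono) auto
  qed (use r d in auto)
  also have "\<dots> = 12 * d / r ^ 3"
    using r by (simp add: field_simps eval_nat_numeral)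
  finally show ?thesis by (simp add: r_def)
qed

text \<open>Expand the logarithm to second order in \<open>D / z\<close> and freeze the correction
  term at \<open>z\<close>: both errors are of third order in \<open>1 / r\<close>. The cruder
  linear form serves to bound the increment and its second moment.\<close>

lemma lyap_increment:
  fixes z y e D :: complex and k k' B :: real
  assumes units: "y \<in> units" "e \<in> units"
    and k: "\<bar>k\<bar> \<le> B" "\<bar>k'\<bar> \<le> B" and B: "1 \<le> B" "4 * B \<le> cmod z"
    and D: "cmod D \<le> 2 * B"
  defines "r \<equiv> cmod z" and "\<delta> \<equiv> lyap k' e (z + D) - lyap k y z"
  shows lyap_increment_taylor: "\<bar>\<delta> - (2 * Re (D / z) - Re ((D / z)\<^sup>2) - k' * Re (e\<^sup>2 / z\<^sup>2)
      + k * Re (y\<^sup>2 / z\<^sup>2))\<bar> \<le> 152 * B ^ 3 / r ^ 3" (is "\<bar>\<delta> - ?T\<bar> \<le> _")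
    and lyap_increment_linear: "\<bar>\<delta> - 2 * Re (D / z)\<bar> \<le> 44 * B\<^sup>2 / r\<^sup>2"
proof -
  define w where "w = D / z"
  have r: "0 < r" "4 * B \<le> r" using B by (auto simp: r_def)
  have z: "z \<noteq> 0" using r r_def by auto
  have w: "cmod w \<le> 2 * B / r"
    using D r by (simp add: w_def norm_divide divide_right_mono flip: r_def)
  have "2 * B / r \<le> 1/2" using r by (simp add: field_simps)
  with w have w_half: "cmod w \<le> 1/2" by linarith
  have "cmod w ^ 3 \<le> (2 * B / r) ^ 3" using w by (intro power_mono) auto
  then have w3: "cmod w ^ 3 \<le> 8 * B ^ 3 / r ^ 3" by (simp add: power_divide power_mult_distrib)
  have "(cmod w)\<^sup>2 \<le> (2 * B / r)\<^sup>2" using w by (intro power_mono) auto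
  then have w2: "(cmod w)\<^sup>2 \<le> 4 * B\<^sup>2 / r\<^sup>2" by (simp add: power_divide power_mult_distrib)
  have "z + D = z * (1 + w)" using z by (simp add: w_def field_simps)
  moreover have "1 + w \<noteq> 0"
  proof
    assume "1 + w = 0"
    then have "w = -1" by (simp add: add_eq_0_iff)
    with w_half show False by simp
  qed
  ultimately have ln: "ln (cmod (z + D)) = ln r + ln (cmod (1 + w))"
    using z by (simp add: norm_mult ln_mult r_def)
  define a where "a = k' * Re (e\<^sup>2 / (z + D)\<^sup>2) - k' * Re (e\<^sup>2 / z\<^sup>2)"
  have "a = k' * Re (e\<^sup>2 * (1 / (z + D)\<^sup>2 - 1 / z\<^sup>2))"
    by (simp add: a_def right_diff_distrib)
  also have "\<bar>\<dots>\<bar> \<le> B * (12 * (2 * B) / r ^ 3)"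
  proof (unfold abs_mult, rule mult_mono[OF k(2)])
    have "cmod (1 / (z + D)\<^sup>2 - 1 / z\<^sup>2) \<le> 12 * (2 * B) / r ^ 3"
      unfolding r_def by (rule norm_inverse_square_diff) (use D B z in auto)
    then have "cmod (e\<^sup>2 * (1 / (z + D)\<^sup>2 - 1 / z\<^sup>2)) \<le> 12 * (2 * B) / r ^ 3"
      using norm_units[OF units(2)] by (simp add: norm_mult norm_power)
    then show "\<bar>Re (e\<^sup>2 * (1 / (z + D)\<^sup>2 - 1 / z\<^sup>2))\<bar> \<le> 12 * (2 * B) / r ^ 3"
      using abs_Re_le_cmod order_trans by blast
  qed (use B in auto)
  also have "\<dots> = 24 * B\<^sup>2 / r ^ 3" by (simp add: power2_eq_square)
  also have "\<dots> \<le> 24 * B ^ 3 / r ^ 3"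
    using B r by (intro divide_right_mono mult_left_mono power_increasing) auto
  finally have a: "\<bar>a\<bar> \<le> 24 * B ^ 3 / r ^ 3" .
  have \<delta>: "\<delta> = 2 * ln (cmod (1 + w)) - a - k' * Re (e\<^sup>2 / z\<^sup>2) + k * Re (y\<^sup>2 / z\<^sup>2)"
    by (simp add: \<delta>_def lyap_def ln a_def r_def)
  have "\<bar>\<delta> - ?T\<bar> \<le> 16 * cmod w ^ 3 + \<bar>a\<bar>"
    using ln_norm_one_plus_approx[OF w_half] unfolding \<delta> w_def[symmetric] by linarith
  \<comment> \<open>The constant is \<open>16 * 8\<close> from the logarithm plus 24 from freezing
    the correction.\<close>
  also have "\<dots> \<le> 16 * (8 * B ^ 3 / r ^ 3) + 24 * B ^ 3 / r ^ 3"
    using w3 a by linarith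
  finally show main: "\<bar>\<delta> - ?T\<bar> \<le> 152 * B ^ 3 / r ^ 3" by (simp add: field_simps)
  have "\<bar>Re (w\<^sup>2)\<bar> \<le> (cmod w)\<^sup>2" using abs_Re_le_cmod[of "w\<^sup>2"] by (simp add: norm_power)
  moreover have "152 * B ^ 3 / r ^ 3 \<le> 38 * B\<^sup>2 / r\<^sup>2"
  proof -
    have "152 * B ^ 3 / r ^ 3 = 38 * B\<^sup>2 / r\<^sup>2 * (4 * B / r)"
      by (simp add: eval_nat_numeral)
    also have "\<dots> \<le> 38 * B\<^sup>2 / r\<^sup>2 * 1"
      using r B by (intro mult_left_mono) auto
    finally show ?thesis by simp
  qed
  moreover have "B / r\<^sup>2 \<le> B\<^sup>2 / r\<^sup>2"
    using B r by (intro divide_right_mono) (auto simp: power2_eq_square)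
  \<comment> \<open>By \<open>4 * B \<le> r\<close> the cubic error becomes the 38; the square of
    \<open>w\<close> adds 4 and the two correction terms 1 each.\<close>
  ultimately have "\<bar>\<delta> - 2 * Re (D / z)\<bar> \<le> 38 * B\<^sup>2 / r\<^sup>2 + 4 * B\<^sup>2 / r\<^sup>2 + B\<^sup>2 / r\<^sup>2 + B\<^sup>2 / r\<^sup>2"
    using main w2 abs_correction_le[OF k(1) units(1), of z]
      abs_correction_le[OF k(2) units(2), of z] unfolding w_def[symmetric] r_def[symmetric]
    by linarith
  then show "\<bar>\<delta> - 2 * Re (D / z)\<bar> \<le> 44 * B\<^sup>2 / r\<^sup>2" by (simp add: field_simps)
qed

text \<open>The logarithm outgrows the correction, which is at most \<open>B / r\<^sup>2\<close>.
  This keeps \<open>ln (lyap k y z)\<close> nonnegative far out and makes it diverge along escaping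
  paths.\<close>

lemma lyap_eventually_ge:
  "\<exists>R>0. \<forall>z k y. R \<le> cmod z \<longrightarrow> \<bar>k\<bar> \<le> B \<longrightarrow> y \<in> units \<longrightarrow> K \<le> lyap k y z"
proof -
  have "filterlim (\<lambda>r::real. 2 * ln r - B / r\<^sup>2) at_top at_top" by real_asymp
  then have "\<forall>\<^sub>F r in at_top. K \<le> 2 * ln r - B / r\<^sup>2 \<and> 0 < r"
    by (auto simp: filterlim_at_top eventually_conj_iff eventually_gt_at_top)
  then obtain R where R: "\<And>r. R \<le> r \<Longrightarrow> K \<le> 2 * ln r - B / r\<^sup>2 \<and> 0 < r"
    by (auto simp: eventually_at_top_linorder)
  show ?thesis
  proof (intro exI[of _ R] conjI allI impI)
    fix z k y assume *: "R \<le> cmod z" "\<bar>k\<bar> \<le> B" "y \<in> units"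
    show "K \<le> lyap k y z"
      using R[OF *(1)] abs_correction_le[OF *(2,3), of z] unfolding lyap_def by linarith
  qed (use R[of R] in simp)
qed

text \<open>With \<open>L\<close> the current value and \<open>\<delta>\<close> its increment,
  \<open>ln (1 + \<delta> / L) \<le> \<delta> / L - \<delta>\<^sup>2 / (4 * L\<^sup>2)\<close>, so
  it suffices that \<open>4 * L\<close> times the mean of \<delta> is at most the mean of its
  square. The former is at most of order \<open>ln r / r ^ 3\<close>, the latter at least of order
  \<open>1 / r\<^sup>2\<close>; the last hypothesis says how large \<open>r\<close> has to
  be.\<close>

lemma redraw_ln_lyap_le:
  fixes z y :: complex and H p k k' B c :: real
  assumes p: "c \<le> p" "p \<le> 1" "0 < c" and y: "y \<in> units" and H: "1 \<le> H" "H \<le> B"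
    and k: "\<bar>k\<bar> \<le> B" "\<bar>k'\<bar> \<le> B" "k = (1 - p) * k' + H\<^sup>2 * p * (1 - p)"
    and far: "30 * B \<le> cmod z" "1 \<le> lyap k y z"
      "608 * B ^ 3 * ((2 * ln (cmod z) + B) / cmod z) + 1936 * B ^ 4 / (cmod z)\<^sup>2 \<le> c"
  shows "redraw p y (\<lambda>e. ln (lyap k' e (z + H * (e - complex_of_real (1 - p) * y)))) \<le> ln (lyap k y z)"
proof -
  define r where "r = cmod z"
  define L where "L = lyap k y z"
  define D where "D e = H * (e - complex_of_real (1 - p) * y)" for e
  define \<delta> where "\<delta> e = lyap k' e (z + D e) - L" for e
  define X where "X e = Re (D e / z)" for e
  have B: "1 \<le> B" using H by linarith
  have r: "30 * B \<le> r" "0 < r" using far B by (auto simp: r_def)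
  have z: "z \<noteq> 0" using r r_def by auto
  have L: "1 \<le> L" using far by (simp add: L_def)
  have D: "cmod (D e) \<le> 2 * B" if "e \<in> units" for e
  proof -
    have "cmod (e - complex_of_real (1 - p) * y) \<le> cmod e + cmod (complex_of_real (1 - p) * y)" by (rule norm_triangle_ineq4)
    also have "cmod (complex_of_real (1 - p) * y) \<le> 1"
      unfolding norm_mult norm_of_real using p norm_units[OF y] by simp
    also have "cmod e + 1 = 2" using norm_units[OF that] by simp
    finally have "H * cmod (e - complex_of_real (1 - p) * y) \<le> B * 2" using H B by (intro mult_mono) auto
    then show ?thesis using H by (simp add: D_def norm_mult)
  qed
  have taylor: "\<delta> e \<le> 2 * X e - Re ((D e / z)\<^sup>2) - k' * Re (e\<^sup>2 / z\<^sup>2)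
      + k * Re (y\<^sup>2 / z\<^sup>2) + 152 * B ^ 3 / r ^ 3" if "e \<in> units" for e
    using lyap_increment_taylor[OF y that k(1,2) B(1) _ D[OF that], of z] far(1) B
    unfolding \<delta>_def X_def L_def r_def by linarith
  have lin: "\<bar>\<delta> e - 2 * X e\<bar> \<le> 44 * B\<^sup>2 / r\<^sup>2" if "e \<in> units" for e
    using lyap_increment_linear[OF y that k(1,2) B(1) _ D[OF that], of z] far(1) B
    unfolding \<delta>_def X_def L_def r_def by linarith
  have small: "\<bar>\<delta> e\<bar> \<le> 1/2" if "e \<in> units" for e
  proof -
    have "\<bar>X e\<bar> \<le> cmod (D e) / r" unfolding X_def r_def
      using abs_Re_le_cmod[of "D e / z"] by (simp add: norm_divide)
    also have "\<dots> \<le> 2 * B / r" using D[OF that] r by (intro divide_right_mono) auto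
    finally have X: "\<bar>X e\<bar> \<le> 2 * (B / r)" by simp
    have Br: "B / r \<le> 1/30" "0 \<le> B / r" using r B by (auto simp: field_simps)
    have "44 * B\<^sup>2 / r\<^sup>2 = 44 * (B / r) * (B / r)" by (simp add: power2_eq_square)
    also have "\<dots> \<le> 44 * (1/30) * (1/30)" using Br by (intro mult_mono) auto
    finally have "44 * B\<^sup>2 / r\<^sup>2 \<le> 44/900" by simp
    moreover have "\<bar>X e\<bar> \<le> 1/15" using X Br(1) by linarith
    ultimately show ?thesis using lin[OF that] by linarith
  qed
  \<comment> \<open>The terms \<open>1 *\<close> and \<open>0 * 0\<close> put the bound in the shape
    of \<open>redraw_affine\<close>.\<close>
  have "redraw p y \<delta> \<le> redraw p y (\<lambda>e. 1 * (2 * X e - Re ((D e / z)\<^sup>2) - k' * Re (e\<^sup>2 / z\<^sup>2)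
      + k * Re (y\<^sup>2 / z\<^sup>2)) + 0 * 0 + 152 * B ^ 3 / r ^ 3)"
    using p y taylor by (intro redraw_mono) auto
  also have "\<dots> = 152 * B ^ 3 / r ^ 3"
    using redraw_taylor[OF k(3) z, of y] by (subst redraw_affine) (simp add: X_def D_def)
  finally have mean: "redraw p y \<delta> \<le> 152 * B ^ 3 / r ^ 3" .
  \<comment> \<open>Uses \<open>(2 * X e)\<^sup>2 \<le> 2 * (\<delta> e)\<^sup>2 + 2 * (\<delta> e -
    2 * X e)\<^sup>2\<close>, so that the linear part bounds the second moment of \<delta> from
    below.\<close>
  have "redraw p y (\<lambda>e. 2 * (X e)\<^sup>2 + 0 * 0 + (- ((44 * B\<^sup>2 / r\<^sup>2)\<^sup>2))) \<le> redraw p y (\<lambda>e. (\<delta> e)\<^sup>2)"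
  proof (rule redraw_mono)
    fix e assume e: "e \<in> units"
    have "(\<delta> e - 2 * X e)\<^sup>2 \<le> (44 * B\<^sup>2 / r\<^sup>2)\<^sup>2"
      by (rule power2_le_iff_abs_le[THEN iffD2]) (use lin[OF e] in auto)
    moreover have "0 \<le> (2 * \<delta> e - 2 * X e)\<^sup>2" by simp
    ultimately show "2 * (X e)\<^sup>2 + 0 * 0 + (- ((44 * B\<^sup>2 / r\<^sup>2)\<^sup>2)) \<le> (\<delta> e)\<^sup>2"
      by (simp add: power2_eq_square algebra_simps)
  qed (use p y in auto)
  then have "2 * redraw p y (\<lambda>e. (X e)\<^sup>2) - (44 * B\<^sup>2 / r\<^sup>2)\<^sup>2 \<le> redraw p y (\<lambda>e. (\<delta> e)\<^sup>2)"
    by (subst (asm) redraw_affine) simp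
  moreover have "p * (cmod (H / z))\<^sup>2 / 2 \<le> redraw p y (\<lambda>e. (X e)\<^sup>2)"
    using redraw_variance[of p y "H / z"] p y unfolding X_def D_def by simp
  moreover have "c / r\<^sup>2 \<le> p * (cmod (H / z))\<^sup>2"
  proof -
    have "c * 1 \<le> p * H\<^sup>2" using p H by (intro mult_mono) auto
    then show ?thesis using r
      by (simp add: norm_divide power_divide divide_right_mono flip: r_def)
  qed
  ultimately have var: "c / r\<^sup>2 - (44 * B\<^sup>2 / r\<^sup>2)\<^sup>2 \<le> redraw p y (\<lambda>e. (\<delta> e)\<^sup>2)" by linarith
  have "B / r\<^sup>2 \<le> B / 1" using r B by (intro divide_left_mono one_le_power) auto
  then have L_le: "L \<le> 2 * ln r + B"
    using abs_correction_le[OF k(1) y, of z] unfolding L_def lyap_def r_def by simp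
  have "608 * B ^ 3 * (L / r) \<le> 608 * B ^ 3 * ((2 * ln r + B) / r)"
    using L_le r B by (intro mult_left_mono divide_right_mono) auto
  with far(3) have "608 * B ^ 3 * (L / r) + 1936 * B ^ 4 / r\<^sup>2 \<le> c" by (simp add: r_def)
  then have "(608 * B ^ 3 * (L / r) + 1936 * B ^ 4 / r\<^sup>2) / r\<^sup>2 \<le> c / r\<^sup>2"
    by (intro divide_right_mono) auto
  \<comment> \<open>Here \<open>608 = 4 * 152\<close> comes from the bound on the mean and
    \<open>1936 = 44\<^sup>2\<close> from the error of the linear approximation.\<close>
  moreover have "(608 * B ^ 3 * (L / r) + 1936 * B ^ 4 / r\<^sup>2) / r\<^sup>2
      = 4 * L * (152 * B ^ 3 / r ^ 3) + (44 * B\<^sup>2 / r\<^sup>2)\<^sup>2"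
    using r by (simp add: field_simps eval_nat_numeral)
  ultimately have "4 * L * (152 * B ^ 3 / r ^ 3) \<le> redraw p y (\<lambda>e. (\<delta> e)\<^sup>2)"
    using var by linarith
  moreover have "4 * L * redraw p y \<delta> \<le> 4 * L * (152 * B ^ 3 / r ^ 3)"
    using mean L by (intro mult_left_mono) auto
  ultimately have drift: "4 * L * redraw p y \<delta> \<le> redraw p y (\<lambda>e. (\<delta> e)\<^sup>2)" by linarith
  have "redraw p y (\<lambda>e. ln (lyap k' e (z + D e)))
      \<le> redraw p y (\<lambda>e. (1 / L) * \<delta> e + (- 1 / (4 * L\<^sup>2)) * (\<delta> e)\<^sup>2 + ln L)"
  proof (rule redraw_mono)
    fix e assume e: "e \<in> units"
    have half: "\<bar>\<delta> e / L\<bar> \<le> 1/2" using small[OF e] L by (simp add: abs_divide divide_le_eq)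
    have "lyap k' e (z + D e) = L * (1 + \<delta> e / L)"
      using L by (simp add: \<delta>_def field_simps)
    moreover have "1 + \<delta> e / L > 0" using half by linarith
    ultimately have "ln (lyap k' e (z + D e)) = ln L + ln (1 + \<delta> e / L)"
      using L by (simp add: ln_mult)
    also have "\<dots> \<le> ln L + (\<delta> e / L - (\<delta> e / L)\<^sup>2 / 4)"
      using ln_one_plus_le_quadratic[OF half] by simp
    finally show "ln (lyap k' e (z + D e))
        \<le> (1 / L) * \<delta> e + (- 1 / (4 * L\<^sup>2)) * (\<delta> e)\<^sup>2 + ln L"
      by (simp add: power_divide)
  qed (use p y in auto)
  also have "\<dots> = (4 * L * redraw p y \<delta> - redraw p y (\<lambda>e. (\<delta> e)\<^sup>2)) / (4 * L\<^sup>2) + ln L"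
    using L by (subst redraw_affine) (simp add: field_simps power2_eq_square)
  also have "\<dots> \<le> ln L" using drift by (simp add: divide_nonpos_nonneg)
  finally show ?thesis by (simp add: D_def L_def)
qed

text \<open>One radius serves all parameters at once. The bound \<open>1 \<le> lyap k y z\<close>
  already holds from \<open>R / 2\<close> on, so that it survives one further step from outside
  \<open>R\<close>, of length at most \<open>2 * B \<le> R / 2\<close>.\<close>

lemma redraw_ln_lyap_eventually_le:
  fixes B c :: real
  assumes "1 \<le> B" "0 < c"
  obtains R where "4 * B \<le> R"
    "\<And>k y z. R / 2 \<le> cmod z \<Longrightarrow> \<bar>k\<bar> \<le> B \<Longrightarrow> y \<in> units \<Longrightarrow> 1 \<le> lyap k y z"
    "\<And>z y p H k k'. \<lbrakk>R \<le> cmod z; y \<in> units; p = 0 \<or> c \<le> p; p \<le> 1; 1 \<le> H; H \<le> B;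
        \<bar>k\<bar> \<le> B; \<bar>k'\<bar> \<le> B; k = (1 - p) * k' + H\<^sup>2 * p * (1 - p)\<rbrakk> \<Longrightarrow>
      redraw p y (\<lambda>e. ln (lyap k' e (z + H * (e - complex_of_real (1 - p) * y)))) \<le> ln (lyap k y z)"
proof -
  obtain R1 where R1: "R1 > 0"
    "\<And>k y z. R1 \<le> cmod z \<Longrightarrow> \<bar>k\<bar> \<le> B \<Longrightarrow> y \<in> units \<Longrightarrow> 1 \<le> lyap k y z"
    using lyap_eventually_ge[of B 1] by blast
  have "((\<lambda>r::real. 608 * B ^ 3 * ((2 * ln r + B) / r) + 1936 * B ^ 4 / r\<^sup>2) \<longlongrightarrow> 0) at_top"
    by real_asymp
  then have "\<forall>\<^sub>F r in at_top. 608 * B ^ 3 * ((2 * ln r + B) / r) + 1936 * B ^ 4 / r\<^sup>2 < c"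
    using assms(2) by (rule order_tendstoD)
  then obtain R2 where R2:
    "\<And>r. R2 \<le> r \<Longrightarrow> 608 * B ^ 3 * ((2 * ln r + B) / r) + 1936 * B ^ 4 / r\<^sup>2 < c"
    by (auto simp: eventually_at_top_linorder)
  define R where "R = max (30 * B) (max (2 * R1) R2)"
  show thesis
  proof (rule that)
    show "4 * B \<le> R" using assms by (simp add: R_def)
    show "1 \<le> lyap k y z" if "R / 2 \<le> cmod z" "\<bar>k\<bar> \<le> B" "y \<in> units" for k y z
      by (rule R1(2)) (use that in \<open>auto simp: R_def\<close>)
    show "redraw p y (\<lambda>e. ln (lyap k' e (z + H * (e - complex_of_real (1 - p) * y)))) \<le> ln (lyap k y z)"
      if *: "R \<le> cmod z" "y \<in> units" "p = 0 \<or> c \<le> p" "p \<le> 1" "1 \<le> H" "H \<le> B"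
        "\<bar>k\<bar> \<le> B" "\<bar>k'\<bar> \<le> B" "k = (1 - p) * k' + H\<^sup>2 * p * (1 - p)" for z y p H k k'
    proof (cases "p = 0")
      \<comment> \<open>The step is repeated, so the increment vanishes; as also
        \<open>k = k'\<close>, both sides agree.\<close>
      case True then show ?thesis using * by (simp add: redraw_def)
    next
      case False
      have "R1 \<le> cmod z" "R2 \<le> cmod z" "30 * B \<le> cmod z"
        using * R1(1) by (auto simp: R_def)
      then show ?thesis
        using * False assms R1(2)[of z k y] R2[of "cmod z"]
        by (intro redraw_ln_lyap_le[where c = c and B = B]) auto
    qed
  qed
qed

section \<open>Periodic recursions\<close>

text \<open>Iterating once around the period gives \<open>x n = F n + P n r * x (n + r)\<close>. The
  product \<open>P n r\<close> is the same for all \<open>n \<ge> N\<close> and is less than 1 owing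
  to \<open>a m\<close>, so the periodic solution is \<open>F n / (1 - P m r)\<close>.\<close>

lemma periodic_recursion_solution:
  fixes a b :: "nat \<Rightarrow> real"
  assumes a: "\<And>n. n \<ge> N \<Longrightarrow> 0 \<le> a n" "\<And>n. n \<ge> N \<Longrightarrow> a n \<le> 1"
    "\<And>n. n \<ge> N \<Longrightarrow> a (n + r) = a n" and m: "m \<ge> N" "a m < 1"
    and b: "\<And>n. n \<ge> N \<Longrightarrow> 0 \<le> b n" "\<And>n. n \<ge> N \<Longrightarrow> b (n + r) = b n"
    and r: "r \<ge> 1"
  shows "\<exists>x. \<forall>n\<ge>N. 0 \<le> x n \<and> x (n + r) = x n \<and> x n = a n * x (Suc n) + b n"
proof -
  define P where "P n j = (\<Prod>i<j. a (n + i))" for n j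
  define F where "F n = (\<Sum>j<r. P n j * b (n + j))" for n
  have P_Suc: "a n * P (Suc n) j = P n (Suc j)" for n j
    unfolding P_def by (subst prod.lessThan_Suc_shift) simp
  have P_const: "P n r = P m r" if "n \<ge> N" for n
  proof -
    have step: "P (Suc n) r = P n r" if "n \<ge> N" for n
    proof -
      obtain s where s: "r = Suc s" using r by (cases r) auto
      have "P (Suc n) r = P (Suc n) s * a (n + r)" by (simp add: P_def s)
      also have "\<dots> = P n r" using a(3)[OF that] P_Suc[of n s] by (simp add: s mult.commute)
      finally show ?thesis .
    qed
    have "P n r = P N r" if "n \<ge> N" for n
      using that by (induction rule: dec_induct) (simp_all add: step)
    from this[OF that] this[OF m(1)] show ?thesis by simp
  qed
  have P_nonneg: "0 \<le> P n j" if "n \<ge> N" for n j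
    unfolding P_def using that a(1) by (intro prod_nonneg) auto
  have A: "P m r < 1"
  proof -
    have "P (Suc m) (r - 1) \<le> 1"
      unfolding P_def using m a(1,2) by (intro prod_le_1) auto
    then have "a m * P (Suc m) (r - 1) \<le> a m * 1" using a(1) m by (intro mult_left_mono) auto
    then show ?thesis using P_Suc[of m "r - 1"] r m(2) by simp
  qed
  define x where "x n = F n / (1 - P m r)" for n
  show ?thesis
  proof (intro exI[of _ x] allI impI conjI)
    fix n assume n: "n \<ge> N"
    show "0 \<le> x n"
      unfolding x_def F_def using A n b(1) P_nonneg by (auto intro!: divide_nonneg_pos sum_nonneg)
    have "P (n + r) j = P n j" for j
      unfolding P_def using a(3)[of "n + _"] n by (intro prod.cong) (auto simp: ac_simps)
    moreover have "b (n + r + j) = b (n + j)" for j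
      using b(2)[of "n + j"] n by (simp add: add.commute add.left_commute)
    ultimately show "x (n + r) = x n" by (simp add: x_def F_def)
    have "a n * F (Suc n) = (\<Sum>j<r. P n (Suc j) * b (n + Suc j))"
      unfolding F_def sum_distrib_left by (simp add: P_Suc flip: mult.assoc)
    also have "b n + \<dots> = (\<Sum>j<Suc r. P n j * b (n + j))"
      by (subst sum.lessThan_Suc_shift) (simp add: P_def)
    also have "\<dots> = F n + P m r * b n"
      using P_const[OF n] b(2)[OF n] by (simp add: F_def)
    finally have "F n = a n * F (Suc n) + (1 - P m r) * b n" by (simp add: algebra_simps)
    then show "x n = a n * x (Suc n) + b n"
      using A by (simp add: x_def field_simps)
  qed
qed

text \<open>Reduces bounds over an infinite tail to a maximum or minimum over one period.\<close>

lemma eventually_periodic_range: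
  fixes x :: "nat \<Rightarrow> 'a"
  assumes "\<And>n. n \<ge> N \<Longrightarrow> x (n + r) = x n" "r \<ge> 1" "n \<ge> N"
  shows "x n \<in> x ` {N..<N + r}"
  using assms(3)
proof (induction n rule: less_induct)
  case (less n)
  show ?case
  proof (cases "n < N + r")
    case False
    then have "x (n - r) \<in> x ` {N..<N + r}" using assms(2) by (intro less) auto
    moreover have "x n = x (n - r)" using assms(1)[of "n - r"] False by simp
    ultimately show ?thesis by simp
  qed (use less in auto)
qed

section \<open>Expectations over finite histories\<close>

text \<open>Adaptedness, stated on trajectories; coordinate 0 is left out because steps are numbered
  from 1.\<close>

definition depends_on_first :: "nat \<Rightarrow> ((nat \<Rightarrow> 'a) \<Rightarrow> 'b) \<Rightarrow> bool" where
  "depends_on_first n f \<longleftrightarrow> (\<forall>y y'. (\<forall>i\<in>{1..n}. y i = y' i) \<longrightarrow> f y = f y')"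

lemma depends_on_firstD:
  "depends_on_first n f \<Longrightarrow> (\<And>i. 1 \<le> i \<Longrightarrow> i \<le> n \<Longrightarrow> y i = y' i) \<Longrightarrow> f y = f y'"
  by (auto simp: depends_on_first_def)

lemma depends_on_first_mono:
  "depends_on_first m f \<Longrightarrow> m \<le> n \<Longrightarrow> depends_on_first n f"
  unfolding depends_on_first_def by (meson atLeastAtMost_iff order_trans)

lemma finite_directions: "finite (directions :: (real ^ 'd) set)"
proof (rule card_ge_0_finite)
  show "card (directions :: (real ^ 'd) set) > 0" by (simp add: card_directions)
qed

lemma axis_in_directions: "axis i 1 \<in> directions"
  by (auto simp: directions_def)

text \<open>The fixed default outside \<open>{1..n}\<close> makes the set finite while every
  coordinate, including 0, is a direction, as \<open>Y_markov\<close> requires.\<close>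

definition histories :: "nat \<Rightarrow> (nat \<Rightarrow> real ^ 'd) set" where
  "histories n = PiE_dflt {1..n} (axis undefined 1) (\<lambda>_. directions)"

lemma finite_histories: "finite (histories n)"
  unfolding histories_def using finite_directions by (intro finite_PiE_dflt) auto

lemma histories_in_directions: "y \<in> histories n \<Longrightarrow> y i \<in> directions"
  using axis_in_directions by (cases "i \<in> {1..n}") (auto simp: histories_def PiE_dflt_def)

lemma sum_histories_Suc:
  "(\<Sum>y\<in>histories (Suc n). f y) = (\<Sum>y\<in>histories n. \<Sum>e\<in>directions. f (y(Suc n := e)))"
proof -
  have "(\<Sum>y\<in>histories n. \<Sum>e\<in>directions. f (y(Suc n := e)))
      = (\<Sum>(y, e)\<in>histories n \<times> directions. f (y(Suc n := e)))"
    using finite_histories finite_directions by (simp add: sum.cartesian_product)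
  also have "\<dots> = (\<Sum>y\<in>histories (Suc n). f y)"
    by (rule sum.reindex_bij_witness[where j = "\<lambda>(y, e). y(Suc n := e)"
          and i = "\<lambda>y. (y(Suc n := axis undefined 1), y (Suc n))"])
      (auto simp: histories_def PiE_dflt_def fun_eq_iff le_Suc_eq)
  finally show ?thesis by simp
qed

section \<open>Path probabilities and expectations\<close>

context conservative_random_walk
begin

definition cylinder :: "nat \<Rightarrow> (nat \<Rightarrow> real ^ 'd) \<Rightarrow> 'w set" where
  "cylinder n y = {\<omega> \<in> space M. \<forall>i\<in>{1..n}. Y i \<omega> = y i}"

lemma Y_in_directions: "1 \<le> i \<Longrightarrow> \<omega> \<in> space M \<Longrightarrow> Y i \<omega> \<in> directions"
  using measurable_space[OF Y_directions] by simp

lemma sets_cylinder [measurable]: "cylinder n y \<in> events"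
proof -
  have *: "{\<omega> \<in> space M. Y i \<omega> = y i} \<in> events" if "1 \<le> i" for i
  proof -
    have "{\<omega> \<in> space M. Y i \<omega> = y i} = Y i -` ({y i} \<inter> directions) \<inter> space M"
      using Y_in_directions[OF that] by auto
    also have "\<dots> \<in> events" using Y_directions[OF that] by (rule measurable_sets) auto
    finally show ?thesis .
  qed
  show ?thesis unfolding cylinder_def by (intro sets.sets_Collect_finite_All *) auto
qed

text \<open>The Markov property without conditioning; it covers null cylinders too, where both sides
  vanish.\<close>

lemma prob_cylinder_Suc:
  assumes "n \<ge> 1" "\<And>i. y i \<in> directions"
  shows "prob (cylinder (Suc n) y) = prob (cylinder n y) * transition p n (y n) (y (Suc n))"
proof (cases "prob (cylinder n y) = 0")
  case True
  have "prob (cylinder (Suc n) y) \<le> prob (cylinder n y)"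
    using sets_cylinder by (intro finite_measure_mono) (auto simp: cylinder_def)
  with True show ?thesis by (simp add: measure_le_0_iff)
next
  case False
  then have pos: "\<P>(\<omega> in M. \<forall>i\<in>{1..n}. Y i \<omega> = y i) > 0"
    by (simp add: cylinder_def zero_less_measure_iff)
  have "{\<omega> \<in> space M. Y (Suc n) \<omega> = y (Suc n) \<and> (\<forall>i\<in>{1..n}. Y i \<omega> = y i)} = cylinder (Suc n) y"
    by (auto simp: cylinder_def atLeastAtMostSuc_conv)
  with Y_markov[OF assms pos] False show ?thesis
    by (simp add: cond_prob_def field_simps flip: cylinder_def[of n, simplified])
qed

text \<open>The cylinders of the finitely many histories partition the space and \<open>f\<close> is
  constant on each, so the variable is a simple function.\<close>

lemma
  fixes f :: "(nat \<Rightarrow> real ^ 'd) \<Rightarrow> real"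
  assumes "depends_on_first n f"
  shows integrable_depends_on_first: "integrable M (\<lambda>\<omega>. f (\<lambda>i. Y i \<omega>))"
    and expectation_depends_on_first:
      "expectation (\<lambda>\<omega>. f (\<lambda>i. Y i \<omega>)) = (\<Sum>y\<in>histories n. prob (cylinder n y) * f y)"
proof -
  have eq: "f (\<lambda>i. Y i \<omega>) = (\<Sum>y\<in>histories n. indicator (cylinder n y) \<omega> * f y)"
    if "\<omega> \<in> space M" for \<omega>
  proof -
    define y0 where "y0 i = (if i \<in> {1..n} then Y i \<omega> else axis undefined 1)" for i
    have y0: "y0 \<in> histories n"
      using that Y_in_directions by (auto simp: y0_def histories_def PiE_dflt_def)
    have "indicator (cylinder n y) \<omega> * f y = (if y = y0 then f y else 0)"
      if "y \<in> histories n" for y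
    proof -
      have "y = y0 \<longleftrightarrow> \<omega> \<in> cylinder n y"
        using that \<open>\<omega> \<in> space M\<close>
        unfolding y0_def cylinder_def histories_def PiE_dflt_def fun_eq_iff mem_Collect_eq
        by metis
      then show ?thesis by (simp add: indicator_def)
    qed
    then have "(\<Sum>y\<in>histories n. indicator (cylinder n y) \<omega> * f y) = f y0"
      using y0 by (simp add: finite_histories)
    also have "\<dots> = f (\<lambda>i. Y i \<omega>)"
      by (rule depends_on_firstD[OF assms]) (simp add: y0_def)
    finally show ?thesis by simp
  qed
  have int: "integrable M (\<lambda>\<omega>. indicator (cylinder n y) \<omega> * f y)" for y
    by (intro integrable_mult_left integrable_real_indicator) (auto simp: emeasure_eq_measure)
  show "integrable M (\<lambda>\<omega>. f (\<lambda>i. Y i \<omega>))"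
    by (subst Bochner_Integration.integrable_cong[OF refl eq]) (use int in auto)
  show "expectation (\<lambda>\<omega>. f (\<lambda>i. Y i \<omega>)) = (\<Sum>y\<in>histories n. prob (cylinder n y) * f y)"
    by (subst Bochner_Integration.integral_cong[OF refl eq])
      (use int in \<open>auto simp: Int_absorb1 sets.sets_into_space\<close>)
qed

text \<open>Integrates a pointwise drift inequality: splitting off the last step writes both
  expectations as sums over histories of length \<open>n\<close> with the same weights.\<close>

lemma expectation_step_le:
  fixes f g :: "(nat \<Rightarrow> real ^ 'd) \<Rightarrow> real"
  assumes "n \<ge> 1" "depends_on_first n f" "depends_on_first (Suc n) g"
    and le: "\<And>y. (\<And>i. y i \<in> directions) \<Longrightarrow>
      (\<Sum>e\<in>directions. transition p n (y n) e * g (y(Suc n := e))) \<le> f y"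
  shows "expectation (\<lambda>\<omega>. g (\<lambda>i. Y i \<omega>)) \<le> expectation (\<lambda>\<omega>. f (\<lambda>i. Y i \<omega>))"
proof -
  have "expectation (\<lambda>\<omega>. g (\<lambda>i. Y i \<omega>))
      = (\<Sum>y\<in>histories n. \<Sum>e\<in>directions. prob (cylinder (Suc n) (y(Suc n := e))) * g (y(Suc n := e)))"
    by (simp add: expectation_depends_on_first[OF assms(3)] sum_histories_Suc)
  also have "\<dots> = (\<Sum>y\<in>histories n. prob (cylinder n y) *
      (\<Sum>e\<in>directions. transition p n (y n) e * g (y(Suc n := e))))"
  proof (rule sum.cong[OF refl])
    fix y :: "nat \<Rightarrow> real ^ 'd" assume y: "y \<in> histories n"
    have "prob (cylinder (Suc n) (y(Suc n := e))) = prob (cylinder n y) * transition p n (y n) e"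
      if "e \<in> directions" for e
    proof -
      have "cylinder n (y(Suc n := e)) = cylinder n y" by (simp add: cylinder_def)
      then show ?thesis
        using prob_cylinder_Suc[OF assms(1), of "y(Suc n := e)"] histories_in_directions[OF y] that
        by simp
    qed
    then show "(\<Sum>e\<in>directions. prob (cylinder (Suc n) (y(Suc n := e))) * g (y(Suc n := e)))
      = prob (cylinder n y) * (\<Sum>e\<in>directions. transition p n (y n) e * g (y(Suc n := e)))"
      by (simp add: sum_distrib_left mult.assoc)
  qed
  also have "\<dots> \<le> (\<Sum>y\<in>histories n. prob (cylinder n y) * f y)"
    using histories_in_directions by (intro sum_mono mult_left_mono le) auto
  also have "\<dots> = expectation (\<lambda>\<omega>. f (\<lambda>i. Y i \<omega>))"
    by (simp add: expectation_depends_on_first[OF assms(2)])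
  finally show ?thesis .
qed

lemma sets_depends_on_first:
  assumes "depends_on_first n Q"
  shows "{\<omega> \<in> space M. Q (\<lambda>i. Y i \<omega>)} \<in> events"
proof -
  have "depends_on_first n (\<lambda>y. of_bool (Q y) :: real)"
    using assms by (auto simp: depends_on_first_def)
  from borel_measurable_integrable[OF integrable_depends_on_first[OF this]]
  have "{\<omega> \<in> space M. (of_bool (Q (\<lambda>i. Y i \<omega>)) :: real) > 0} \<in> events" by measurable
  then show ?thesis by simp
qed

section \<open>A Lyapunov criterion against divergence\<close>

lemma transition_nonneg: "n \<ge> 1 \<Longrightarrow> 0 \<le> transition p n x y"
  using p_range[of n] by (auto simp: transition_def Let_def)

text \<open>Killing \<open>V\<close> at the first failure of \<open>A\<close> leaves a nonnegative
  supermartingale \<open>g\<close>. By Markov's inequality, at each time \<open>V\<close> reaches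
  \<open>K\<close> before killing with probability at most \<open>C / K\<close>; on \<open>E\<close>
  it does so at all late times, so letting \<open>K\<close> grow gives 0.\<close>

lemma lyapunov_recurrence:
  fixes V :: "nat \<Rightarrow> (nat \<Rightarrow> real ^ 'd) \<Rightarrow> real" and A :: "nat \<Rightarrow> (nat \<Rightarrow> real ^ 'd) \<Rightarrow> bool"
  assumes N: "N \<ge> 1"
    and V: "\<And>n. depends_on_first n (V n)" and A: "\<And>n. depends_on_first n (A n)"
    and nonneg: "\<And>n y. n \<ge> N \<Longrightarrow> (\<And>i. y i \<in> directions) \<Longrightarrow> A n y \<Longrightarrow> 0 \<le> V n y"
    and nonneg_Suc: "\<And>n y. n \<ge> N \<Longrightarrow> (\<And>i. y i \<in> directions) \<Longrightarrow> A n y \<Longrightarrow> 0 \<le> V (Suc n) y"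
    and drift: "\<And>n y. n \<ge> N \<Longrightarrow> (\<And>i. y i \<in> directions) \<Longrightarrow> A n y \<Longrightarrow>
      (\<Sum>e\<in>directions. transition p n (y n) e * V (Suc n) (y(Suc n := e))) \<le> V n y"
    and E: "E \<in> events" "\<And>\<omega> n. \<omega> \<in> E \<Longrightarrow> n \<ge> N \<Longrightarrow> A n (\<lambda>i. Y i \<omega>)"
      "\<And>\<omega>. \<omega> \<in> E \<Longrightarrow> filterlim (\<lambda>n. V n (\<lambda>i. Y i \<omega>)) at_top sequentially"
  shows "prob E = 0"
proof -
  define A' where "A' n y \<longleftrightarrow> (\<forall>m\<in>{N..n}. A m y)" for n y
  define g where "g n y = (if A' n y then V n y else 0)" for n y
  have A': "depends_on_first n (A' n)" for n
  proof -
    have "A m y = A m y'" if "m \<le> n" "\<forall>i\<in>{1..n}. y i = y' i" for m y y'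
      using depends_on_first_mono[OF A that(1)] that(2) by (auto simp: depends_on_first_def)
    then show ?thesis unfolding depends_on_first_def A'_def by (metis atLeastAtMost_iff)
  qed
  have g: "depends_on_first n (g n)" for n
    using A'[of n] V[of n] unfolding depends_on_first_def g_def by metis
  have g_nonneg: "0 \<le> g n (\<lambda>i. Y i \<omega>)" if "n \<ge> N" "\<omega> \<in> space M" for n \<omega>
  proof -
    \<comment> \<open>\<open>Y 0\<close> need not be a direction, so coordinate 0 is replaced by one
      before \<open>nonneg\<close> is applied.\<close>
    define y where "y i = (if i = 0 then axis undefined 1 else Y i \<omega>)" for i
    have "y i \<in> directions" for i
      using that Y_in_directions[of i \<omega>] by (simp add: y_def axis_in_directions)
    then have "0 \<le> g n y"
      using that(1) nonneg[of n y] by (auto simp: g_def A'_def)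
    then show ?thesis using depends_on_firstD[OF g, of n y "\<lambda>i. Y i \<omega>"] by (simp add: y_def)
  qed
  have step_le: "expectation (\<lambda>\<omega>. g (Suc n) (\<lambda>i. Y i \<omega>)) \<le> expectation (\<lambda>\<omega>. g n (\<lambda>i. Y i \<omega>))"
    if n: "n \<ge> N" for n
  proof (rule expectation_step_le)
    fix y :: "nat \<Rightarrow> real ^ 'd" assume y: "\<And>i. y i \<in> directions"
    have A'_upd: "A' n (y(Suc n := e)) \<longleftrightarrow> A' n y" for e
      by (rule depends_on_firstD[OF A']) auto
    have A'_Suc: "A' (Suc n) y' \<Longrightarrow> A' n y'" for y' by (auto simp: A'_def)
    show "(\<Sum>e\<in>directions. transition p n (y n) e * g (Suc n) (y(Suc n := e))) \<le> g n y"
    proof (cases "A' n y")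
      case True
      then have "A n y" using n by (auto simp: A'_def)
      \<comment> \<open>If \<open>A\<close> fails at time \<open>Suc n\<close>, then
        \<open>g\<close> drops to 0, which is still at most \<open>V\<close> by
        \<open>nonneg_Suc\<close>.\<close>
      have "g (Suc n) (y(Suc n := e)) \<le> V (Suc n) (y(Suc n := e))" if "e \<in> directions" for e
      proof -
        have "A n (y(Suc n := e))"
          using A'_upd[of e] True n by (auto simp: A'_def)
        then show ?thesis unfolding g_def using nonneg_Suc[OF n, of "y(Suc n := e)"] y that by auto
      qed
      then have "(\<Sum>e\<in>directions. transition p n (y n) e * g (Suc n) (y(Suc n := e)))
          \<le> (\<Sum>e\<in>directions. transition p n (y n) e * V (Suc n) (y(Suc n := e)))"
        using n N by (intro sum_mono mult_left_mono) (auto simp: transition_nonneg)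
      also have "\<dots> \<le> V n y" using drift[OF n y \<open>A n y\<close>] .
      finally show ?thesis using True by (simp add: g_def)
    next
      case False
      then have "\<not> A' (Suc n) (y(Suc n := e))" for e using A'_Suc A'_upd by blast
      then show ?thesis using False by (simp add: g_def)
    qed
  qed (use n N g in auto)
  define C where "C = expectation (\<lambda>\<omega>. g N (\<lambda>i. Y i \<omega>))"
  have C: "expectation (\<lambda>\<omega>. g n (\<lambda>i. Y i \<omega>)) \<le> C" if "n \<ge> N" for n
    using that
  proof (induction rule: dec_induct)
    case (step n)
    then show ?case using step_le[of n] by linarith
  qed (simp add: C_def)
  have bound: "prob E \<le> C / K" if K: "K > 0" for K
  proof -
    define F where "F n = {\<omega> \<in> space M. A' n (\<lambda>i. Y i \<omega>) \<and> K \<le> V n (\<lambda>i. Y i \<omega>)}" for n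
    have F: "F n \<in> events" for n
      unfolding F_def using A'[of n] V[of n]
      by (intro sets_depends_on_first[of n "\<lambda>y. A' n y \<and> K \<le> V n y"])
        (unfold depends_on_first_def, metis)
    have prob_F: "prob (F n) \<le> C / K" if n: "n \<ge> N" for n
    proof -
      have "prob (F n) = expectation (indicator (F n))" using F by (simp add: Int_absorb2 F_def)
      also have "\<dots> \<le> expectation (\<lambda>\<omega>. g n (\<lambda>i. Y i \<omega>) / K)"
      proof (intro integral_mono integrable_real_indicator integrable_divide)
        fix \<omega> assume \<omega>: "\<omega> \<in> space M"
        show "indicator (F n) \<omega> \<le> g n (\<lambda>i. Y i \<omega>) / K"
          using g_nonneg[OF n \<omega>] K by (cases "\<omega> \<in> F n") (auto simp: F_def g_def)
      qed (use F[of n] integrable_depends_on_first[OF g[of n]] in \<open>auto simp: emeasure_eq_measure\<close>)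
      also have "\<dots> \<le> C / K" using C[OF n] K by (simp add: divide_right_mono)
      finally show ?thesis .
    qed
    \<comment> \<open>The part of \<open>E\<close> where \<open>V\<close> is at least
      \<open>K\<close> from time \<open>max m N\<close> on; these events increase to
      \<open>E\<close>, and each lies in a single \<open>F n\<close>.\<close>
    define E' where "E' m = (E \<inter> (\<Inter>n\<in>{max m N..}. F n))" for m
    have E'_sets: "E' m \<in> events" for m
      unfolding E'_def using E(1) F by (intro sets.Int sets.countable_INT') auto
    have E'_UN: "(\<Union>m. E' m) = E"
    proof (intro equalityI subsetI)
      fix \<omega> assume \<omega>: "\<omega> \<in> E"
      obtain m where m: "\<And>n. n \<ge> m \<Longrightarrow> K \<le> V n (\<lambda>i. Y i \<omega>)"
        using E(3)[OF \<omega>] by (auto simp: filterlim_at_top eventually_sequentially)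
      have "\<omega> \<in> E' m"
        using \<omega> m E sets.sets_into_space[OF E(1)] by (auto simp: E'_def F_def A'_def)
      then show "\<omega> \<in> (\<Union>m. E' m)" by blast
    qed (auto simp: E'_def)
    have "incseq E'" by (auto simp: incseq_def E'_def)
    then have "(\<lambda>m. prob (E' m)) \<longlonglongrightarrow> prob (\<Union>m. E' m)"
      using E'_sets by (intro finite_Lim_measure_incseq) auto
    moreover have "prob (E' m) \<le> C / K" for m
    proof -
      have "prob (E' m) \<le> prob (F (max m N))"
        using F by (intro finite_measure_mono) (auto simp: E'_def)
      also have "\<dots> \<le> C / K" by (rule prob_F) simp
      finally show ?thesis .
    qed
    ultimately show ?thesis unfolding E'_UN by (intro LIMSEQ_le_const2) auto
  qed
  have "(\<lambda>k. C / real (Suc k)) \<longlonglongrightarrow> 0"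
    by (rule LIMSEQ_Suc[where f = "\<lambda>k. C / real k"]) (rule lim_const_over_n)
  then have "prob E \<le> 0" by (rule LIMSEQ_le_const) (use bound in auto)
  then show ?thesis by (simp add: measure_le_0_iff)
qed

end

section \<open>Non-escape in the plane\<close>

definition to_complex :: "real ^ 2 \<Rightarrow> complex" where
  "to_complex v = Complex (v $ 1) (v $ 2)"

lemma to_complex_add: "to_complex (u + v) = to_complex u + to_complex v"
  by (simp add: to_complex_def complex_eq_iff)

lemma to_complex_sum: "to_complex (sum f I) = (\<Sum>i\<in>I. to_complex (f i))"
  by (induction I rule: infinite_finite_induct)
    (simp_all add: to_complex_add, simp_all add: to_complex_def complex_eq_iff)

lemma norm_to_complex: "cmod (to_complex v) = norm v"
  by (simp add: to_complex_def norm_vec_def L2_set_def sum_2 complex_norm)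

lemma inj_to_complex: "inj to_complex"
  by (auto simp: inj_def to_complex_def vec_eq_iff forall_2)

lemma to_complex_directions: "to_complex ` directions = units"
proof -
  have "directions = {axis 1 1, axis 2 1, - axis 1 1, - axis 2 1 :: real ^ 2}"
    by (auto simp: directions_def) (metis exhaust_2)+
  then have "to_complex ` directions = to_complex ` {axis 1 1, axis 2 1, - axis 1 1, - axis 2 1}"
    by simp
  also have "\<dots> = {1, \<i>, -1, -\<i>}"
    by (simp add: to_complex_def axis_def Complex_eq)
  finally show ?thesis by (auto simp: units_def)
qed

text \<open>Here \<open>2 * CARD(2) = 4\<close>; time 1 is excluded because the kernel then uses 1
  in place of \<open>p 1\<close>.\<close>

lemma sum_transition_eq_redraw:
  fixes x :: "real ^ 2"
  assumes "n \<noteq> 1" "x \<in> directions"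
  shows "(\<Sum>e\<in>directions. transition p n x e * f (to_complex e)) = redraw (p n) (to_complex x) f"
proof -
  have "(\<Sum>e\<in>directions. transition p n x e * f (to_complex e))
      = (\<Sum>e\<in>directions. if x = e then (1 - p n) * f (to_complex e) else 0)
        + (\<Sum>e\<in>directions. p n / 4 * f (to_complex e))"
    unfolding sum.distrib[symmetric] using assms(1)
    by (intro sum.cong) (auto simp: transition_def field_simps)
  also have "(\<Sum>e\<in>directions. p n / 4 * f (to_complex e)) = (\<Sum>u\<in>units. p n / 4 * f u)"
    unfolding to_complex_directions[symmetric]
    by (subst sum.reindex) (auto intro: inj_on_subset[OF inj_to_complex])
  also have "\<dots> = p n * (f 1 + f (-1) + f \<i> + f (-\<i>)) / 4"
    by (simp add: units_def complex_eq_iff algebra_simps)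
  finally show ?thesis
    using assms(2) by (simp add: redraw_def sum.delta finite_directions)
qed

theorem theorem5p1:
  fixes M :: "'w measure" and p :: "nat \<Rightarrow> real" and Y :: "nat \<Rightarrow> 'w \<Rightarrow> real ^ 2"
  assumes p_range: "\<And>n. n \<ge> 2 \<Longrightarrow> 0 \<le> p n \<and> p n \<le> 1"
    and p_sum: "filterlim (\<lambda>N. \<Sum>n = 2..N. p n) at_top sequentially"
    and p_periodic: "\<exists>r\<ge>1. \<exists>n0. \<forall>n\<ge>n0. p (n + r) = p n"
    and crw: "conservative_random_walk M p Y"
  shows "\<not> strongly_transient M (walk Y) \<and> measure M (escape_event M (walk Y)) = 0"
proof -
  interpret conservative_random_walk M p Y by (rule crw)
  obtain r n0 where r: "r \<ge> 1" and "\<And>n. n \<ge> n0 \<Longrightarrow> p (n + r) = p n"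
    using p_periodic by blast
  \<comment> \<open>Taking \<open>N \<ge> 2\<close> makes \<open>p_range\<close> available and
    avoids the convention at time 1.\<close>
  moreover define N where "N = max n0 2"
  ultimately have N: "N \<ge> 2" and per: "\<And>n. n \<ge> N \<Longrightarrow> p (n + r) = p n" by auto
  have p01: "0 \<le> p n" "p n \<le> 1" if "n \<ge> N" for n using p_range[of n] N that by auto
  \<comment> \<open>Otherwise the partial sums would be constant from \<open>N\<close> on. The
    factor \<open>1 - p m < 1\<close> makes the two recursions below contract over a period.\<close>
  obtain m where m: "m \<ge> N" "p m > 0"
  proof -
    have "\<exists>m\<ge>N. p m > 0"
    proof (rule ccontr)
      assume "\<not> ?thesis"
      then have zero: "p n = 0" if "n \<ge> N" for n using p01(1)[OF that] that by force
      have "(\<Sum>n = 2..n. p n) = (\<Sum>n = 2..N. p n)" if "n \<ge> N" for n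
        using that by (induction rule: dec_induct) (use zero N in auto)
      moreover have "\<forall>\<^sub>F n in sequentially. (\<Sum>n = 2..N. p n) < (\<Sum>n = 2..n. p n)"
        using p_sum by (simp add: filterlim_at_top_dense)
      ultimately have "\<forall>\<^sub>F n in sequentially. n < N"
        by (elim eventually_mono) (metis less_irrefl linorder_not_less)
      then show False unfolding eventually_sequentially by (metis le_add1 le_add2 linorder_not_less)
    qed
    then show thesis using that by blast
  qed
  \<comment> \<open>The next step has conditional mean \<open>1 - p n\<close> times the current one,
    so the expected future sum obeys \<open>h n = (1 - p n) * (1 + h (Suc n))\<close>.\<close>
  have "\<exists>h. \<forall>n\<ge>N. 0 \<le> h n \<and> h (n + r) = h n \<and> h n = (1 - p n) * h (Suc n) + (1 - p n)"
    by (rule periodic_recursion_solution[of N _ _ m]) (use m r in \<open>simp_all add: p01 per\<close>)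
  then obtain h where h: "\<And>n. n \<ge> N \<Longrightarrow> 0 \<le> h n" "\<And>n. n \<ge> N \<Longrightarrow> h (n + r) = h n"
    "\<And>n. n \<ge> N \<Longrightarrow> h n = (1 - p n) * h (Suc n) + (1 - p n)"
    by blast
  \<comment> \<open>This is the relation between \<open>k\<close> and \<open>k'\<close> in
    \<open>redraw_taylor\<close>, with \<open>H = 1 + h (Suc n)\<close>.\<close>
  have "\<exists>\<kappa>. \<forall>n\<ge>N. 0 \<le> \<kappa> n \<and> \<kappa> (n + r) = \<kappa> n
      \<and> \<kappa> n = (1 - p n) * \<kappa> (Suc n) + (1 + h (Suc n))\<^sup>2 * p n * (1 - p n)"
  proof (rule periodic_recursion_solution[of N _ _ m])
    show "(1 + h (Suc (n + r)))\<^sup>2 * p (n + r) * (1 - p (n + r))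
        = (1 + h (Suc n))\<^sup>2 * p n * (1 - p n)" if "n \<ge> N" for n
      using h(2)[of "Suc n"] per[OF that] that by simp
  qed (use m r in \<open>simp_all add: p01 per\<close>)
  then obtain \<kappa> where \<kappa>: "\<And>n. n \<ge> N \<Longrightarrow> 0 \<le> \<kappa> n" "\<And>n. n \<ge> N \<Longrightarrow> \<kappa> (n + r) = \<kappa> n"
    "\<And>n. n \<ge> N \<Longrightarrow> \<kappa> n = (1 - p n) * \<kappa> (Suc n) + (1 + h (Suc n))\<^sup>2 * p n * (1 - p n)"
    by blast
  \<comment> \<open>The least positive value over one period bounds all nonzero \<open>p n\<close>
    with \<open>n \<ge> N\<close> from below.\<close>
  define c where "c = Min {x \<in> p ` {N..<N + r}. 0 < x}"
  have p_mem: "p n \<in> {x \<in> p ` {N..<N + r}. 0 < x}" if "n \<ge> N" "p n \<noteq> 0" for n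
    using eventually_periodic_range[of N p r n] per r p01(1)[of n] that by auto
  have "c \<in> {x \<in> p ` {N..<N + r}. 0 < x}"
    unfolding c_def using p_mem[OF m(1)] m(2) by (intro Min_in) auto
  then have c: "0 < c" by simp
  have c_le: "p n = 0 \<or> c \<le> p n" if "n \<ge> N" for n
    using p_mem[OF that] unfolding c_def by (auto intro!: Min_le)
  define B where "B = 1 + Max (h ` {N..<N + r}) + Max (\<kappa> ` {N..<N + r})"
  have hB: "1 + h n \<le> B" "\<kappa> n \<le> B" if "n \<ge> N" for n
  proof -
    have "h n \<le> Max (h ` {N..<N + r})" "\<kappa> n \<le> Max (\<kappa> ` {N..<N + r})"
      using eventually_periodic_range[of N h r n] eventually_periodic_range[of N \<kappa> r n] h(2) \<kappa>(2) r that
      by (auto intro!: Max_ge)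
    then show "1 + h n \<le> B" "\<kappa> n \<le> B"
      using h(1)[OF that] \<kappa>(1)[OF that] unfolding B_def by linarith+
  qed
  have B: "1 \<le> B" using hB[of N] h(1)[of N] by simp
  obtain R where R: "4 * B \<le> R"
    and lyap_ge: "\<And>k y z. R / 2 \<le> cmod z \<Longrightarrow> \<bar>k\<bar> \<le> B \<Longrightarrow> y \<in> units \<Longrightarrow> 1 \<le> lyap k y z"
    and lyap_step: "\<And>z y p H k k'. \<lbrakk>R \<le> cmod z; y \<in> units; p = 0 \<or> c \<le> p; p \<le> 1; 1 \<le> H; H \<le> B;
        \<bar>k\<bar> \<le> B; \<bar>k'\<bar> \<le> B; k = (1 - p) * k' + H\<^sup>2 * p * (1 - p)\<rbrakk> \<Longrightarrow>
      redraw p y (\<lambda>e. ln (lyap k' e (z + H * (e - complex_of_real (1 - p) * y)))) \<le> ln (lyap k y z)"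
    using redraw_ln_lyap_eventually_le[OF B c] by blast
  \<comment> \<open>\<open>h n\<close> times the current step is the expected sum of all future steps, so \<open>Z\<close> is a martingale.\<close>
  define S where "S n y = (\<Sum>i = 1..n. to_complex (y i))" for n and y :: "nat \<Rightarrow> real ^ 2"
  define Z where "Z n y = S n y + h n * to_complex (y n)" for n and y :: "nat \<Rightarrow> real ^ 2"
  \<comment> \<open>The value 0 before \<open>N\<close> keeps \<open>V n\<close> a function of
    coordinates 1 to \<open>n\<close>, also at \<open>n = 0\<close>, where the formula would read
    \<open>y 0\<close>.\<close>
  define V where "V n y = (if n < N then 0 else ln (lyap (\<kappa> n) (to_complex (y n)) (Z n y)))" for n y
  define A where "A n y \<longleftrightarrow> N \<le> n \<and> R \<le> cmod (Z n y)" for n y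
  have dep: "Z n y = Z n y' \<and> y n = y' n" if "N \<le> n" "\<forall>i\<in>{1..n}. y i = y' i" for n y y'
    using that N by (simp add: Z_def S_def)
  have unit: "to_complex e \<in> units" if "e \<in> directions" for e
    using that to_complex_directions by blast
  have Z_Suc: "Z (Suc n) (y(Suc n := e)) = Z n y
      + (1 + h (Suc n)) * (to_complex e - complex_of_real (1 - p n) * to_complex (y n))"
    if "n \<ge> N" for n y e
  proof -
    \<comment> \<open>By the recursion, removing the old term \<open>h n * to_complex (y n)\<close>
      amounts to centring the new step, scaled by \<open>1 + h (Suc n)\<close>.\<close>
    have "complex_of_real (h n) = (1 + h (Suc n)) * (1 - p n)"
      by (subst h(3)[OF that]) (simp add: algebra_simps)
    then show ?thesis
      using that N by (simp add: Z_def S_def) (simp add: algebra_simps)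
  qed
  have walk: "cmod (S n (\<lambda>i. Y i \<omega>)) = norm (walk Y n \<omega>)" for n \<omega>
    by (simp add: S_def walk_def to_complex_sum[symmetric] norm_to_complex)
  have Z_near: "\<bar>cmod (Z n y) - cmod (S n y)\<bar> \<le> B" if "n \<ge> N" "y n \<in> directions" for n y
  proof -
    have "\<bar>cmod (Z n y) - cmod (S n y)\<bar> \<le> cmod (Z n y - S n y)" by (rule norm_triangle_ineq3)
    also have "\<dots> = h n"
      using norm_units[OF unit[OF that(2)]] h(1)[OF that(1)] by (simp add: Z_def norm_mult)
    finally show ?thesis using hB(1)[OF that(1)] by simp
  qed
  have null: "prob {\<omega> \<in> escape_event M (walk Y). \<forall>n\<ge>k. A n (\<lambda>i. Y i \<omega>)} = 0" (is "prob ?E = 0")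
    and sets: "{\<omega> \<in> escape_event M (walk Y). \<forall>n\<ge>k. A n (\<lambda>i. Y i \<omega>)} \<in> events"
    if k: "k \<ge> N" for k
  proof -
    have depA: "depends_on_first n (A n)" and depV: "depends_on_first n (V n)" for n
    proof -
      have "A n y = A n y' \<and> V n y = V n y'" if "\<forall>i\<in>{1..n}. y i = y' i" for y y'
        using dep[OF _ that] by (cases "n < N") (auto simp: A_def V_def)
      then show "depends_on_first n (A n)" "depends_on_first n (V n)"
        unfolding depends_on_first_def by blast+
    qed
    have "{\<omega> \<in> space M. A n (\<lambda>i. Y i \<omega>)} \<in> events" for n
      using depA by (rule sets_depends_on_first)
    then have "{\<omega> \<in> space M. \<forall>n\<in>{k..}. A n (\<lambda>i. Y i \<omega>)} \<in> events"
      by (intro sets.sets_Collect_countable_Ball) auto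
    then have "escape_event M (walk Y) \<inter> {\<omega> \<in> space M. \<forall>n\<in>{k..}. A n (\<lambda>i. Y i \<omega>)} \<in> events"
      using escape_event_measurable by (rule sets.Int[rotated])
    also have "escape_event M (walk Y) \<inter> {\<omega> \<in> space M. \<forall>n\<in>{k..}. A n (\<lambda>i. Y i \<omega>)} = ?E"
      by (auto simp: escape_event_def)
    finally show E: "?E \<in> events" .
    show "prob ?E = 0"
    proof (rule lyapunov_recurrence[of k V A])
      fix n and y :: "nat \<Rightarrow> real ^ 2"
      assume n: "n \<ge> k" and y: "\<And>i. y i \<in> directions" and "A n y"
      have nN: "N \<le> n" "N \<le> Suc n" using n k by auto
      from \<open>A n y\<close> have far: "R \<le> cmod (Z n y)" by (simp add: A_def)
      have kB: "\<bar>\<kappa> n\<bar> \<le> B" "\<bar>\<kappa> (Suc n)\<bar> \<le> B"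
        using hB(2)[OF nN(1)] hB(2)[OF nN(2)] \<kappa>(1)[OF nN(1)] \<kappa>(1)[OF nN(2)] by auto
      show "0 \<le> V n y"
        using lyap_ge[OF _ kB(1) unit[OF y[of n]], of "Z n y"] far R B nN by (simp add: V_def)
      show "0 \<le> V (Suc n) y"
      proof -
        \<comment> \<open>Overwriting a coordinate by its own value makes \<open>Z_Suc\<close>
          applicable to \<open>y\<close> itself; the increment is at most
          \<open>2 * B \<le> R / 2\<close>.\<close>
        have "Z n y - Z (Suc n) (y(Suc n := y (Suc n)))
            = complex_of_real (1 + h (Suc n)) * (complex_of_real (1 - p n) * to_complex (y n) - to_complex (y (Suc n)))"
          unfolding Z_Suc[OF nN(1)] by (simp add: algebra_simps)
        then have "cmod (Z n y - Z (Suc n) y) = (1 + h (Suc n)) *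
            cmod (complex_of_real (1 - p n) * to_complex (y n) - to_complex (y (Suc n)))"
          using h(1)[OF nN(2)] by (simp add: norm_mult del: of_real_add)
        also have "\<dots> \<le> B * 2"
        proof (rule mult_mono)
          have "cmod (complex_of_real (1 - p n) * to_complex (y n) - to_complex (y (Suc n)))
              \<le> cmod (complex_of_real (1 - p n) * to_complex (y n)) + cmod (to_complex (y (Suc n)))"
            by (rule norm_triangle_ineq4)
          also have "\<dots> \<le> 2"
            unfolding norm_mult norm_of_real
            using p01[OF nN(1)] norm_units[OF unit[OF y]] by simp
          finally show "cmod (complex_of_real (1 - p n) * to_complex (y n) - to_complex (y (Suc n))) \<le> 2" .
        qed (use hB(1)[OF nN(2)] B in auto)
        finally have "R / 2 \<le> cmod (Z (Suc n) y)"
          using far R norm_triangle_sub[of "Z n y" "Z (Suc n) y"] by linarith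
        then show ?thesis
          using lyap_ge[OF _ kB(2) unit[OF y[of "Suc n"]], of "Z (Suc n) y"] nN by (simp add: V_def)
      qed
      define f where "f e = ln (lyap (\<kappa> (Suc n)) e (Z n y
        + complex_of_real (1 + h (Suc n)) * (e - complex_of_real (1 - p n) * to_complex (y n))))" for e
      have "V (Suc n) (y(Suc n := e)) = f (to_complex e)" for e
        using nN by (simp only: V_def f_def Z_Suc[OF nN(1)]) simp
      then have "(\<Sum>e\<in>directions. transition p n (y n) e * V (Suc n) (y(Suc n := e)))
          = redraw (p n) (to_complex (y n)) f"
        using sum_transition_eq_redraw[of n "y n" p f] y[of n] nN N by simp
      also have "\<dots> \<le> ln (lyap (\<kappa> n) (to_complex (y n)) (Z n y))"
        using lyap_step[OF far unit[OF y[of n]] c_le[OF nN(1)] p01(2)[OF nN(1)] _ hB(1)[OF nN(2)] kB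
            \<kappa>(3)[OF nN(1)]] h(1)[OF nN(2)]
        unfolding f_def by linarith
      finally show "(\<Sum>e\<in>directions. transition p n (y n) e * V (Suc n) (y(Suc n := e))) \<le> V n y"
        using nN by (simp add: V_def)
    next
      fix \<omega> assume \<omega>: "\<omega> \<in> ?E"
      show "filterlim (\<lambda>n. V n (\<lambda>i. Y i \<omega>)) at_top sequentially"
        unfolding filterlim_at_top
      proof
        fix C :: real
        obtain R' where R': "\<And>z k y. R' \<le> cmod z \<Longrightarrow> \<bar>k\<bar> \<le> B \<Longrightarrow> y \<in> units \<Longrightarrow> exp C \<le> lyap k y z"
          using lyap_eventually_ge[of B "exp C"] by blast
        have "\<forall>\<^sub>F n in sequentially. R' + B \<le> norm (walk Y n \<omega>)"
          using \<omega> by (simp add: escape_event_def filterlim_at_top)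
        moreover have "\<forall>\<^sub>F n in sequentially. N \<le> n" by (rule eventually_ge_at_top)
        ultimately show "\<forall>\<^sub>F n in sequentially. C \<le> V n (\<lambda>i. Y i \<omega>)"
        proof eventually_elim
          case (elim n)
          have dir: "Y n \<omega> \<in> directions"
            using Y_in_directions[of n \<omega>] \<omega> elim(2) N by (simp add: escape_event_def)
          have "R' \<le> cmod (Z n (\<lambda>i. Y i \<omega>))"
            using Z_near[OF elim(2), of "\<lambda>i. Y i \<omega>"] dir elim(1) walk[of n \<omega>] by linarith
          then have "exp C \<le> lyap (\<kappa> n) (to_complex (Y n \<omega>)) (Z n (\<lambda>i. Y i \<omega>))"
            using hB(2)[OF elim(2)] \<kappa>(1)[OF elim(2)] unit[OF dir] by (intro R') auto
          then have "C \<le> ln (lyap (\<kappa> n) (to_complex (Y n \<omega>)) (Z n (\<lambda>i. Y i \<omega>)))"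
            using exp_gt_zero[of C] by (subst ln_ge_iff) linarith+
          then show ?case using elim(2) by (simp add: V_def)
        qed
      qed
    next
      show "1 \<le> k" using k N by simp
    next
      show "A n (\<lambda>i. Y i \<omega>)" if "\<omega> \<in> ?E" "n \<ge> k" for \<omega> n using that by blast
    qed (rule depV depA E)+
  qed
  \<comment> \<open>\<open>Z\<close> stays within \<open>B\<close> of the walk, so on escape it is
    outside the disc of radius \<open>R\<close> from some time on: countably many null events cover
    the escape event.\<close>
  have "escape_event M (walk Y)
      = (\<Union>k\<in>{N..}. {\<omega> \<in> escape_event M (walk Y). \<forall>n\<ge>k. A n (\<lambda>i. Y i \<omega>)})"
  proof (intro equalityI subsetI)
    fix \<omega> assume \<omega>: "\<omega> \<in> escape_event M (walk Y)"
    then obtain k where k: "\<And>n. n \<ge> k \<Longrightarrow> R + B \<le> norm (walk Y n \<omega>)"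
      by (auto simp: escape_event_def filterlim_at_top eventually_sequentially)
    have "A n (\<lambda>i. Y i \<omega>)" if "n \<ge> max k N" for n
    proof -
      have "Y n \<omega> \<in> directions"
        using Y_in_directions[of n \<omega>] \<omega> that N by (simp add: escape_event_def)
      then show ?thesis
        using Z_near[of n "\<lambda>i. Y i \<omega>"] that k[of n] walk[of n \<omega>] by (simp add: A_def)
    qed
    then show "\<omega> \<in> (\<Union>k\<in>{N..}. {\<omega> \<in> escape_event M (walk Y). \<forall>n\<ge>k. A n (\<lambda>i. Y i \<omega>)})"
      using \<omega> by (intro UN_I[of "max k N"]) auto
  qed auto
  also have "\<dots> \<in> null_sets M"
  proof (rule null_sets_UN')
    fix k assume "k \<in> {N..}"
    then have k: "N \<le> k" by simp
    show "{\<omega> \<in> escape_event M (walk Y). \<forall>n\<ge>k. A n (\<lambda>i. Y i \<omega>)} \<in> null_sets M"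
      by (rule null_setsI[OF _ sets[OF k]]) (simp only: emeasure_eq_measure null[OF k] ennreal_0)
  qed simp
  finally have "prob (escape_event M (walk Y)) = 0" by (simp add: measure_eq_0_null_sets)
  then show ?thesis by (simp add: strongly_transient_def)
qed

end
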